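(* Let $k$ be a positive integer. For integers $n_k,\ldots,n_1$ write $N=kn_k+(k-1)n_{k-1}+\cdots+2n_2+n_1$. Define polynomials $b(n_k,n_{k-1},\ldots,n_1)$ in $q$ by $b(0,\ldots,0)=1$, $b(n_k,\ldots,n_1)=0$ if $n_j<0$ for any $j\in\{1,\ldots,k\}$, and, for all $n_k,\ldots,n_1\ge0$ not all zero, $$b(n_k,\ldots,n_1)=\sum_{j=1}^{k}\left[\prod_{i=2}^{j}\left(1+q+q^2+\cdots+q^{N-i}\right)\right]q^{\sum_{i=j+1}^{k}(i-j)n_i}\; b(n_k,\ldots,n_{j+1},n_j-1,n_{j-1},\ldots,n_1).$$ Then, as formal power series in $x$ and $q$, $$\frac{(x^{k+1}q^{k+1};q^{k+1})_\infty}{(xq;q)_\infty}=\sum_{n_k,\ldots,n_1\ge0}\frac{q^{\sum_{i=1}^{k}\binom{n_k+n_{k-1}+\cdots+n_i+1}{2}}\,(1-q)^{\sum_{i=2}^{k}(i-1)n_i}\,x^{N}}{(q;q)_{N}}\; b(n_k,n_{k-1},\ldots,n_1).$$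
   Context: Notation: $(a;q)_n=\prod_{j=1}^n(1-aq^{j-1})$ (so $(a;q)_0=1$) and $(a;q)_\infty=\prod_{j\ge1}(1-aq^{j-1})$; similarly $(a;q^{k+1})_\infty=\prod_{j\ge1}(1-aq^{(k+1)(j-1)})$. Empty products equal $1$ and empty sums equal $0$. In the recurrence, a term in which $b$ has a negative argument is read as $0$; when $n_j\ge1$ one has $N\ge j$, so the exponents $N-i$ with $2\le i\le j$ are nonnegative. *)

theory Defs
  imports "HOL-Analysis.Analysis"
begin

text \<open>
  Formal power series in \<open>x\<close> and \<open>q\<close> over \<open>'a\<close> are represented as power series in \<open>q\<close> whose
  coefficients are power series in \<open>x\<close>. Convergence is with respect to the library's metric on
  \<^typ>\<open>'b fps\<close>, here the \<open>q\<close>-adic one: every coefficient of a power of \<open>q\<close> is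
  eventually constant. The opposite nesting would not do, since \<open>(xq;q)\<^sub>\<infinity>\<close> does not
  converge \<open>x\<close>-adically.
\<close>

abbreviation var_q :: "'a::field fps fps" where
  "var_q \<equiv> fps_X"

abbreviation var_x :: "'a::field fps fps" where
  "var_x \<equiv> fps_const fps_X"

definition qpoch :: "'b::comm_ring_1 \<Rightarrow> 'b \<Rightarrow> nat \<Rightarrow> 'b" where
  "qpoch a q n = (\<Prod>j=1..n. 1 - a * q ^ (j - 1))"

text \<open>The library's infinite products are indexed from \<open>0\<close>.\<close>

definition qpoch_inf :: "'b::{comm_ring_1,t2_space} \<Rightarrow> 'b \<Rightarrow> 'b" where
  "qpoch_inf a q = (\<Prod>j. 1 - a * q ^ j)"

definition weight :: "nat \<Rightarrow> (nat \<Rightarrow> 'b) \<Rightarrow> 'b::comm_semiring_1" where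
  "weight k n = (\<Sum>i=1..k. of_nat i * n i)"

text \<open>
  A tuple \<open>(n\<^sub>k, \<dots>, n\<^sub>1)\<close> is a function of which only the values on \<open>{1..k}\<close> matter.
  Negative arguments are allowed and give \<open>0\<close>. In the recurrence, \<open>nat\<close> truncates
  \<open>N - i\<close> only in summands with \<open>n\<^sub>j = 0\<close>, which vanish because of the last factor.
\<close>

function b_poly :: "nat \<Rightarrow> (nat \<Rightarrow> int) \<Rightarrow> int poly" where
  "b_poly k n =
     (if \<exists>j\<in>{1..k}. n j < 0 then 0
      else if \<forall>j\<in>{1..k}. n j = 0 then 1
      else \<Sum>j=1..k.
        (\<Prod>i=2..j. \<Sum>m=0..nat (weight k n - int i). monom 1 m) *
        monom 1 (nat (\<Sum>i=j+1..k. int (i - j) * n i)) *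
        b_poly k (n(j := n j - 1)))"
  by pat_completeness auto
termination
proof (relation "Wellfounded.measure (\<lambda>(k, n). \<Sum>j=1..k. nat (n j + 1))", goal_cases)
  case (2 k n j)
  have "nat (n j) < nat (n j + 1)"
    using 2 by force
  then have "(\<Sum>i=1..k. nat ((n(j := n j - 1)) i + 1)) < (\<Sum>i=1..k. nat (n i + 1))"
    using 2(3) by (intro sum_strict_mono_ex1) auto
  then show ?case by simp
qed (rule wf_measure)

declare b_poly.simps [simp del]

lemma convergent_prod_qpoch:
  fixes a q :: "'b::{idom} fps"
  assumes "fps_nth a 0 = 0" "fps_nth q 0 = 0"
  shows "convergent_prod (\<lambda>j. 1 - a * q ^ j)"
proof -
  define P where "P n = (\<Prod>j\<le>n. 1 - a * q ^ j)" for n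
  have step: "fps_nth (P (Suc n)) m = fps_nth (P n) m" if "m \<le> n" for m n
  proof -
    have "q = fps_X * fps_shift 1 q"
      using assms by (intro fps_ext) (simp add: fps_X_mult_nth)
    then have c: "q ^ Suc n = fps_X ^ Suc n * fps_shift 1 q ^ Suc n"
      by (metis power_mult_distrib)
    have "P (Suc n) = P n - fps_X ^ Suc n * (fps_shift 1 q ^ Suc n * a * P n)"
      unfolding P_def prod.atMost_Suc c by (simp only: algebra_simps mult_1_left)
    then show ?thesis
      using that by (simp only: fps_sub_nth fps_X_power_mult_nth) simp
  qed
  have const: "fps_nth (P n) m = fps_nth (P m) m" if "m \<le> n" for m n
    using that by (induction n rule: dec_induct) (auto simp: step)
  define L where "L = Abs_fps (\<lambda>m. fps_nth (P m) m)"
  have "P \<longlonglongrightarrow> L"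
  proof (rule tendsto_fpsI)
    fix m
    show "\<forall>\<^sub>F n in sequentially. fps_nth (P n) m = fps_nth L m"
      using eventually_ge_at_top[of m] by eventually_elim (unfold L_def fps_nth_Abs_fps, rule const)
  qed
  moreover have "fps_nth L 0 = 1"
    using assms by (simp add: L_def P_def)
  then have "L \<noteq> 0" by auto
  ultimately show ?thesis
    unfolding convergent_prod_def raw_has_prod_def P_def
    by (intro exI[of _ 0] exI[of _ L]) simp
qed

end

theory Submission
  imports Defs
begin

unbundle no vec_syntax
unbundle fps_syntax

text \<open>
  The left-hand side \<open>F(x) = (x\<^bsup>k+1\<^esup>q\<^bsup>k+1\<^esup>; q\<^bsup>k+1\<^esup>)\<^sub>\<infinity> / (xq; q)\<^sub>\<infinity>\<close> is
  \<open>\<Prod>\<^sub>j (1 + xq\<^bsup>j\<^esup> + \<dots> + x\<^bsup>k\<^esup>q\<^bsup>kj\<^esup>)\<close>, hence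
  \<open>F(x) = (1 + xq + \<dots> + x\<^bsup>k\<^esup>q\<^bsup>k\<^esup>) F(xq)\<close>. Comparing coefficients of \<open>x\<^bsup>N\<^esup>\<close>, where
  \<open>F(x) = \<Sum>\<^sub>N u\<^sub>N x\<^bsup>N\<^esup>\<close>, gives
  \<open>(1 - q\<^bsup>N\<^esup>) u\<^sub>N = q\<^bsup>N\<^esup> (u\<^bsub>N-1\<^esub> + \<dots> + u\<^bsub>N-k\<^esub>)\<close>, where \<open>u\<close> vanishes at
  negative indices. For \<open>G\<^sub>N = (q;q)\<^sub>N u\<^sub>N\<close> this says
  \<open>G\<^sub>N = q\<^bsup>N\<^esup> \<Sum>\<^bsub>1\<le>j\<le>k\<^esub> (\<Prod>\<^bsub>2\<le>i\<le>j\<^esub> (1 - q\<^bsup>N+1-i\<^esup>)) G\<^bsub>N-j\<^esub>\<close>.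
  Together with \<open>G\<^sub>0 = 1\<close> this recurrence determines \<open>G\<close> (lemmas \<open>coeffs_of_quotient\<close> and
  \<open>coeff_times_qpoch\<close>).

  The recurrence for \<open>b\<close> is the same recurrence, refined from the weight \<open>N\<close> to the tuples of
  weight \<open>N\<close>. Call \<open>numer\<close> the numerator of the summand at \<open>n\<close> without its power of \<open>x\<close>.
  Lowering \<open>n\<^sub>j\<close> by one lowers the weight by \<open>j\<close>. It removes \<open>j - 1\<close> factors \<open>1 - q\<close>, which turn
  the \<open>q\<close>-integers in the recurrence for \<open>b\<close> into \<open>\<Prod>\<^bsub>2\<le>i\<le>j\<^esub> (1 - q\<^bsup>N+1-i\<^esup>)\<close>. The change of the
  triangular exponent and the exponent \<open>\<Sum>\<^bsub>i>j\<^esub> (i - j) n\<^sub>i\<close> add up to exactly \<open>N\<close>, for every \<open>j\<close>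
  (lemma \<open>tri_exp_upd\<close>). So summing \<open>numer\<close> over the tuples of weight \<open>N\<close> gives a
  solution of the recurrence for \<open>G\<close> (lemma \<open>sum_numer_rec\<close>).

  Two points concern formal power series. Infinite products converge \<open>q\<close>-adically, which asks for
  series in \<open>q\<close> with coefficients in \<open>x\<close>, whereas extracting \<open>x\<^bsup>N\<^esup>\<close> and substituting \<open>xq\<close> for \<open>x\<close>
  ask for the opposite nesting; the ring homomorphism \<open>swap_vars\<close> mediates. And the multiple sum
  converges because the triangular exponent is at least the weight, so that only finitely many
  tuples contribute to a given power of \<open>q\<close> (lemma \<open>weight_le_tri_exp\<close>).
\<close>

section \<open>Evaluating integer polynomials in a commutative ring\<close>

abbreviation eval_int :: "int poly \<Rightarrow> 'b::comm_ring_1 \<Rightarrow> 'b" where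
  "eval_int p x \<equiv> poly (map_poly of_int p) x"

lemma eval_int_add: "eval_int (p + r) x = eval_int p x + eval_int r (x::'b::comm_ring_1)"
proof -
  have "map_poly of_int (p + r) = map_poly of_int p + (map_poly of_int r :: 'b poly)"
    by (rule poly_eqI) (simp add: coeff_map_poly)
  then show ?thesis by simp
qed

lemma eval_int_pCons: "eval_int (pCons a p) x = of_int a + x * eval_int p (x::'b::comm_ring_1)"
  by (simp add: map_poly_pCons)

lemma eval_int_smult: "eval_int (smult a p) x = of_int a * eval_int p (x::'b::comm_ring_1)"
  by (induction p) (simp_all add: eval_int_pCons algebra_simps)

lemma eval_int_mult: "eval_int (p * r) x = eval_int p x * eval_int r (x::'b::comm_ring_1)"
  by (induction p) (simp_all add: eval_int_pCons eval_int_add eval_int_smult algebra_simps)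

lemma eval_int_monom: "eval_int (monom 1 m) x = (x::'b::comm_ring_1) ^ m"
  by (simp add: map_poly_monom poly_monom)

lemma eval_int_sum: "eval_int (sum f A) x = (\<Sum>i\<in>A. eval_int (f i) (x::'b::comm_ring_1))"
  by (induction A rule: infinite_finite_induct) (simp_all add: eval_int_add)

lemma eval_int_prod: "eval_int (prod f A) x = (\<Prod>i\<in>A. eval_int (f i) (x::'b::comm_ring_1))"
  by (induction A rule: infinite_finite_induct) (simp_all add: eval_int_mult)

section \<open>The recurrence for the numerators of the summands\<close>

definition tri_exp :: "nat \<Rightarrow> (nat \<Rightarrow> nat) \<Rightarrow> nat" where
  "tri_exp k n = (\<Sum>i=1..k. ((\<Sum>j=i..k. n j) + 1) choose 2)"

definition numer :: "nat \<Rightarrow> 'b::comm_ring_1 \<Rightarrow> (nat \<Rightarrow> nat) \<Rightarrow> 'b" where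
  "numer k q n = q ^ tri_exp k n * (1 - q) ^ (\<Sum>i=2..k. (i - 1) * n i)
     * eval_int (b_poly k (\<lambda>j. int (n j))) q"

lemma sum_upd:
  fixes f :: "nat \<Rightarrow> nat \<Rightarrow> nat"
  assumes "finite A" "j \<in> A" 
  shows "(\<Sum>i\<in>A. f i ((n(j := v)) i)) + f j (n j) = (\<Sum>i\<in>A. f i (n i)) + f j v"
  using assms by (simp add: sum.remove[of A j])

text \<open>
  With \<open>s\<^sub>i = n\<^sub>i + \<dots> + n\<^sub>k\<close>, lowering \<open>n\<^sub>j\<close> lowers \<open>s\<^sub>i\<close> by one exactly for \<open>i \<le> j\<close>, so it lowers
  the exponent by \<open>s\<^sub>1 + \<dots> + s\<^sub>j = \<Sum>\<^sub>l min l j * n\<^sub>l\<close>; and \<open>min l j + (l - j) = l\<close>.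
  This is the reason for the power of \<open>q\<close> in the recurrence for \<open>b_poly\<close>.
\<close>

lemma tri_exp_upd:
  assumes j: "j \<in> {1..k}" and nj: "n j \<ge> 1"
  shows "tri_exp k n + (\<Sum>i=j+1..k. (i - j) * n i)
    = weight k n + tri_exp k (n(j := n j - 1))"
proof -
  define n' where "n' = n(j := n j - 1)"
  define S where "S m i = (\<Sum>l=i..k. m l)" for m :: "nat \<Rightarrow> nat" and i
  have S: "S n i = S n' i + (if i \<le> j then 1 else 0)" if "i \<in> {1..k}" for i
  proof (cases "i \<le> j")
    case True
    then have "S n' i + n j = S n i + (n j - 1)"
      using sum_upd[of "{i..k}" j "\<lambda>_ x. x" n "n j - 1"] j by (simp add: S_def n'_def)
    then show ?thesis using True nj by simp
  next
    case False
    then show ?thesis by (auto simp: S_def n'_def intro!: sum.cong)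
  qed
  have ch: "(s + 2) choose 2 = ((s + 1) choose 2) + (s + 1)" for s :: nat
    by (simp add: numeral_2_eq_2)
  have "tri_exp k n = (\<Sum>i=1..k. (S n i + 1) choose 2)"
    by (simp add: tri_exp_def S_def)
  also have "\<dots> = (\<Sum>i=1..k. ((S n' i + 1) choose 2) + (if i \<le> j then S n i else 0))"
    by (intro sum.cong refl) (use S ch in auto)
  also have "\<dots> = tri_exp k n' + (\<Sum>i=1..k. if i \<le> j then S n i else 0)"
    by (simp add: sum.distrib tri_exp_def S_def)
  also have "(\<Sum>i=1..k. if i \<le> j then S n i else 0)
      = (\<Sum>i=1..k. \<Sum>l=1..k. if i \<le> j \<and> i \<le> l then n l else 0)"
  proof (intro sum.cong refl)
    fix i assume "i \<in> {1..k}"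
    then have "{i..k} = {l\<in>{1..k}. i \<le> l}" by auto
    then show "(if i \<le> j then S n i else 0) = (\<Sum>l=1..k. if i \<le> j \<and> i \<le> l then n l else 0)"
      by (simp add: S_def sum.If_cases Int_def)
  qed
  also have "\<dots> = (\<Sum>l=1..k. \<Sum>i=1..k. if i \<le> j \<and> i \<le> l then n l else 0)"
    by (rule sum.swap)
  also have "\<dots> = (\<Sum>l=1..k. min l j * n l)"
  proof (intro sum.cong refl)
    fix l assume "l \<in> {1..k}"
    then have "{1..k} \<inter> {i. i \<le> j \<and> i \<le> l} = {1..min l j}" using j by auto
    then show "(\<Sum>i=1..k. if i \<le> j \<and> i \<le> l then n l else 0) = min l j * n l"
      by (simp add: sum.If_cases)
  qed
  finally have 1: "tri_exp k n = tri_exp k n' + (\<Sum>l=1..k. min l j * n l)" .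
  have 2: "(\<Sum>i=j+1..k. (i - j) * n i) = (\<Sum>i=1..k. (i - j) * n i)"
    by (rule sum.mono_neutral_left) auto
  have "(\<Sum>l=1..k. min l j * n l) + (\<Sum>i=1..k. (i - j) * n i) = weight k n"
    unfolding weight_def sum.distrib[symmetric]
    by (intro sum.cong refl) (auto simp: min_def simp flip: add_mult_distrib)
  with 1 2 show ?thesis by (simp add: n'_def)
qed

lemma prod_geometric:
  fixes q :: "'b::comm_ring_1"
  assumes "1 \<le> j" "j \<le> N"
  shows "(1 - q) ^ (j - 1) * (\<Prod>i=2..j. \<Sum>m=0..N - i. q ^ m) = (\<Prod>i=2..j. 1 - q ^ (N + 1 - i))"
proof -
  have "(1 - q) ^ (j - 1) = (\<Prod>i=2..j. 1 - q)" by simp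
  then have "(1 - q) ^ (j - 1) * (\<Prod>i=2..j. \<Sum>m=0..N - i. q ^ m)
      = (\<Prod>i=2..j. (1 - q) * (\<Sum>m=0..N - i. q ^ m))"
    by (simp only: prod.distrib)
  also have "\<dots> = (\<Prod>i=2..j. 1 - q ^ (N + 1 - i))"
  proof (intro prod.cong refl)
    fix i assume i: "i \<in> {2..j}"
    have "(1 - q) * (\<Sum>m=0..N - i. q ^ m) = 1 - q ^ Suc (N - i)"
      by (simp only: atLeast0AtMost sum_gp_basic)
    then show "(1 - q) * (\<Sum>m=0..N - i. q ^ m) = 1 - q ^ (N + 1 - i)"
      using i assms by (simp add: Suc_diff_le)
  qed
  finally show ?thesis .
qed

text \<open>
  The two exponents of \<open>q\<close> combine by \<open>tri_exp_upd\<close> into \<open>q ^ weight k n\<close>, which is independent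
  of \<open>j\<close>, and the \<open>q\<close>-integers absorb the surplus factors \<open>1 - q\<close> by \<open>prod_geometric\<close>.
\<close>

lemma numer_rec:
  fixes q :: "'b::comm_ring_1"
  assumes N: "weight k n \<ge> 1"
  shows "numer k q n = q ^ weight k n *
    (\<Sum>j=1..k. if n j \<ge> 1
      then (\<Prod>i=2..j. 1 - q ^ (weight k n + 1 - i)) * numer k q (n(j := n j - 1)) else 0)"
proof -
  let ?N = "weight k n"
  define z where "z = (\<lambda>j. int (n j))"
  have w: "weight k z = int ?N"
    by (simp add: weight_def z_def)
  have "\<not> (\<forall>j\<in>{1..k}. z j = 0)"
  proof
    assume "\<forall>j\<in>{1..k}. z j = 0"
    then have "weight k n = 0" unfolding weight_def z_def by (intro sum.neutral) simp
    with N show False by simp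
  qed
  then have "b_poly k z = (\<Sum>j=1..k.
        (\<Prod>i=2..j. \<Sum>m=0..nat (weight k z - int i). monom 1 m) *
        monom 1 (nat (\<Sum>i=j+1..k. int (i - j) * z i)) *
        b_poly k (z(j := z j - 1)))"
    by (subst b_poly.simps) (auto simp: z_def)
  then have "eval_int (b_poly k z) q = (\<Sum>j=1..k.
        (\<Prod>i=2..j. \<Sum>m=0..nat (weight k z - int i). q ^ m) *
        q ^ (nat (\<Sum>i=j+1..k. int (i - j) * z i)) *
        eval_int (b_poly k (z(j := z j - 1))) q)"
    by (simp only: eval_int_sum eval_int_prod eval_int_mult eval_int_monom)
  then have ev: "numer k q n = (\<Sum>j=1..k. q ^ tri_exp k n * (1 - q) ^ (\<Sum>i=2..k. (i - 1) * n i) * (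
        (\<Prod>i=2..j. \<Sum>m=0..nat (weight k z - int i). q ^ m) *
        q ^ (nat (\<Sum>i=j+1..k. int (i - j) * z i)) *
        eval_int (b_poly k (z(j := z j - 1))) q))"
    unfolding numer_def z_def by (simp only: sum_distrib_left)
  also have "\<dots> = (\<Sum>j=1..k. q ^ ?N * (if n j \<ge> 1
      then (\<Prod>i=2..j. 1 - q ^ (?N + 1 - i)) * numer k q (n(j := n j - 1)) else 0))"
  proof (intro sum.cong refl)
    fix j assume j: "j \<in> {1..k}"
    show "q ^ tri_exp k n * (1 - q) ^ (\<Sum>i=2..k. (i - 1) * n i) * (
        (\<Prod>i=2..j. \<Sum>m=0..nat (weight k z - int i). q ^ m) *
        q ^ (nat (\<Sum>i=j+1..k. int (i - j) * z i)) *
        eval_int (b_poly k (z(j := z j - 1))) q) = q ^ ?N * (if n j \<ge> 1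
      then (\<Prod>i=2..j. 1 - q ^ (?N + 1 - i)) * numer k q (n(j := n j - 1)) else 0)"
    proof (cases "n j \<ge> 1")
      case False
      then have "\<exists>i\<in>{1..k}. (z(j := z j - 1)) i < 0"
        using j by (auto simp: z_def)
      then have "b_poly k (z(j := z j - 1)) = 0"
        by (subst b_poly.simps) (simp only: if_True)
      then show ?thesis using False by simp
    next
      case True
      define n' where "n' = n(j := n j - 1)"
      have z': "z(j := z j - 1) = (\<lambda>i. int (n' i))"
        using True by (auto simp: z_def n'_def)
      \<comment> \<open>Needed so that no exponent \<open>N - i\<close> with \<open>i \<le> j\<close> is truncated.\<close>
      have "j * 1 \<le> j * n j" using True by (intro mult_le_mono2) simp
      also have "\<dots> \<le> ?N"
        unfolding weight_def using j member_le_sum[of j "{1..k}" "\<lambda>i. of_nat i * n i"] by simp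
      finally have jN: "j \<le> ?N" by simp
      have tail: "nat (\<Sum>i=j+1..k. int (i - j) * z i) = (\<Sum>i=j+1..k. (i - j) * n i)"
        unfolding z_def by (simp only: of_nat_mult[symmetric] of_nat_sum[symmetric] nat_int)
      have e: "(\<Sum>i=2..k. (i - 1) * n i) = (j - 1) + (\<Sum>i=2..k. (i - 1) * n' i)"
      proof -
        have *: "(\<Sum>i=2..k. (i - 1) * m i) = (\<Sum>i=1..k. (i - 1) * m i)" for m :: "nat \<Rightarrow> nat"
          by (rule sum.mono_neutral_left) auto
        have "(\<Sum>i=1..k. (i - 1) * n' i) + (j - 1) * n j = (\<Sum>i=1..k. (i - 1) * n i) + (j - 1) * (n j - 1)"
          unfolding n'_def using sum_upd[of "{1..k}" j "\<lambda>i x. (i - 1) * x" n "n j - 1"] j by simp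
        moreover have "(j - 1) * n j = (j - 1) * (n j - 1) + (j - 1)"
          using True by (cases "n j") auto
        ultimately show ?thesis unfolding * by linarith
      qed
      have g: "(1 - q) ^ (j - 1) * (\<Prod>i=2..j. \<Sum>m=0..nat (weight k z - int i). q ^ m)
          = (\<Prod>i=2..j. 1 - q ^ (?N + 1 - i))"
      proof -
        have "nat (weight k z - int i) = ?N - i" for i unfolding w by arith
        then show ?thesis using prod_geometric[of j ?N q] j jN by simp
      qed
      have p: "q ^ tri_exp k n * q ^ (\<Sum>i=j+1..k. (i - j) * n i) = q ^ ?N * q ^ tri_exp k n'"
        unfolding power_add[symmetric] n'_def using tri_exp_upd[of j k n] j True by simp
      have "q ^ tri_exp k n * (1 - q) ^ (\<Sum>i=2..k. (i - 1) * n i) * (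
        (\<Prod>i=2..j. \<Sum>m=0..nat (weight k z - int i). q ^ m) *
        q ^ (nat (\<Sum>i=j+1..k. int (i - j) * z i)) *
        eval_int (b_poly k (z(j := z j - 1))) q)
        = (q ^ tri_exp k n * q ^ (\<Sum>i=j+1..k. (i - j) * n i)) *
          ((1 - q) ^ (j - 1) * (\<Prod>i=2..j. \<Sum>m=0..nat (weight k z - int i). q ^ m)) *
          ((1 - q) ^ (\<Sum>i=2..k. (i - 1) * n' i) * eval_int (b_poly k (\<lambda>i. int (n' i))) q)"
        unfolding tail z' e power_add by (simp only: mult_ac)
      also have "\<dots> = q ^ ?N * ((\<Prod>i=2..j. 1 - q ^ (?N + 1 - i)) * numer k q n')"
        unfolding p g numer_def by (simp only: mult_ac)
      finally show ?thesis using True by (simp add: n'_def)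
    qed
  qed
  finally show ?thesis by (simp only: sum_distrib_left)
qed

definition tuples :: "nat \<Rightarrow> nat \<Rightarrow> (nat \<Rightarrow> nat) set" where
  "tuples k N = {n \<in> {1..k} \<rightarrow>\<^sub>E UNIV. weight k n = N}"

lemma finite_tuples: "finite (tuples k N)"
proof (rule finite_subset)
  show "tuples k N \<subseteq> {1..k} \<rightarrow>\<^sub>E {..N}"
  proof
    fix n assume n: "n \<in> tuples k N"
    have "n j \<le> N" if "j \<in> {1..k}" for j
    proof -
      have "1 * n j \<le> j * n j" using that by (intro mult_le_mono1) simp
      also have "\<dots> \<le> weight k n"
        unfolding weight_def using that member_le_sum[of j "{1..k}" "\<lambda>i. of_nat i * n i"] by simp
      finally show ?thesis using n by (simp add: tuples_def)
    qed
    then show "n \<in> {1..k} \<rightarrow>\<^sub>E {..N}"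
      using n by (auto simp: tuples_def PiE_iff)
  qed
qed (auto intro: finite_PiE)

lemma weight_upd:
  assumes "j \<in> {1..k}"
  shows "weight k (n(j := v)) + j * n j = weight k n + j * (v::nat)"
  unfolding weight_def using sum_upd[of "{1..k}" j "\<lambda>i x. i * x" n v] assms by simp

lemma tuples_0: "tuples k 0 = {\<lambda>i\<in>{1..k}. 0}"
  by (fastforce simp: tuples_def weight_def PiE_iff extensional_def)

lemma numer_zero: "numer k q (\<lambda>i\<in>{1..k}. 0) = 1"
proof -
  have "b_poly k (\<lambda>j. int ((\<lambda>i\<in>{1..k}. 0) j)) = 1"
    by (subst b_poly.simps) simp
  moreover have "tri_exp k (\<lambda>i\<in>{1..k}. 0) = 0"
    by (simp add: tri_exp_def)
  moreover have "(\<Sum>i=2..k. (i - 1) * (\<lambda>i\<in>{1..k}. 0) i) = (0::nat)"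
    by simp
  ultimately show ?thesis by (simp only: numer_def) simp
qed

lemma sum_numer_tuples_0: "sum (numer k q) (tuples k 0) = 1"
  by (simp only: tuples_0 sum.insert sum.empty finite.emptyI empty_iff not_False_eq_True
      numer_zero add_0_right)

lemma sum_tuples_decrement:
  assumes j: "j \<in> {1..k}"
  shows "(\<Sum>n\<in>tuples k N. if n j \<ge> 1 then f (n(j := n j - 1)) else 0)
    = (if j \<le> N then sum f (tuples k (N - j)) else (0::'b::comm_monoid_add))"
proof -
  have w: "weight k (n(j := n j - 1)) + j = weight k n" if "n j \<ge> 1" for n
    using weight_upd[OF j, of n "n j - 1"] that by (cases "n j") auto
  have w2: "weight k (n(j := Suc (n j))) = weight k n + j" for n
    using weight_upd[OF j, of n "Suc (n j)"] by simp
  have "(\<Sum>n\<in>tuples k N. if n j \<ge> 1 then f (n(j := n j - 1)) else 0)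
      = (\<Sum>n\<in>{n\<in>tuples k N. n j \<ge> 1}. f (n(j := n j - 1)))"
    by (rule sum.inter_filter[OF finite_tuples, symmetric])
  also have "\<dots> = (if j \<le> N then sum f (tuples k (N - j)) else 0)"
  proof (cases "j \<le> N")
    case True
    have "(\<Sum>n\<in>{n\<in>tuples k N. n j \<ge> 1}. f (n(j := n j - 1))) = sum f (tuples k (N - j))"
      by (rule sum.reindex_bij_witness[where j = "\<lambda>n. n(j := n j - 1)" and i = "\<lambda>n. n(j := Suc (n j))"])
        (use w w2 True j in \<open>fastforce simp: tuples_def PiE_iff extensional_def\<close>)+
    then show ?thesis using True by simp
  next
    case False
    then have "{n\<in>tuples k N. n j \<ge> 1} = {}"
      using w by (fastforce simp: tuples_def)
    then show ?thesis using False by (simp only: sum.empty if_False)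
  qed
  finally show ?thesis .
qed

lemma sum_numer_rec:
  fixes q :: "'b::comm_ring_1"
  assumes N: "N \<ge> 1"
  shows "sum (numer k q) (tuples k N) = q ^ N * (\<Sum>j=1..k. if j \<le> N
    then (\<Prod>i=2..j. 1 - q ^ (N + 1 - i)) * sum (numer k q) (tuples k (N - j)) else 0)"
proof -
  let ?c = "\<lambda>j. \<Prod>i=2..j. 1 - q ^ (N + 1 - i)"
  have "sum (numer k q) (tuples k N) = (\<Sum>n\<in>tuples k N. q ^ N *
    (\<Sum>j=1..k. if n j \<ge> 1 then ?c j * numer k q (n(j := n j - 1)) else 0))"
    by (intro sum.cong refl) (use N numer_rec in \<open>auto simp: tuples_def\<close>)
  also have "\<dots> = q ^ N * (\<Sum>j=1..k. \<Sum>n\<in>tuples k N. if n j \<ge> 1 then ?c j * numer k q (n(j := n j - 1)) else 0)"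
    unfolding sum_distrib_left[symmetric] by (subst sum.swap) (rule refl)
  also have "(\<Sum>j=1..k. \<Sum>n\<in>tuples k N. if n j \<ge> 1 then ?c j * numer k q (n(j := n j - 1)) else 0)
    = (\<Sum>j=1..k. if j \<le> N then ?c j * sum (numer k q) (tuples k (N - j)) else 0)"
    by (intro sum.cong refl)
      (simp only: sum_tuples_decrement[where f = "\<lambda>n. ?c _ * numer k q n"] sum_distrib_left)
  finally show ?thesis .
qed

section \<open>The factors of the q-factorial\<close>

lemma qpoch_Suc: "qpoch q q (Suc n) = qpoch q q n * (1 - q ^ Suc n)"
  by (simp add: qpoch_def)

text \<open>Multiplying the recurrence for the coefficients by \<open>(q;q)\<^bsub>N-1\<^esub>\<close> creates the products
  \<open>(1 - q\<^bsup>N-1\<^esup>) \<dots> (1 - q\<^bsup>N-j+1\<^esup>)\<close> that are left over after \<open>(q;q)\<^bsub>N-j\<^esub>\<close> has been split off.\<close>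

lemma qpoch_peel:
  assumes "1 \<le> j" "j \<le> N"
  shows "qpoch q q (N - 1) = (\<Prod>i=2..j. 1 - q ^ (N + 1 - i)) * qpoch q q (N - j)"
  using assms
proof (induction j rule: dec_induct)
  case (step j)
  then have "N - j = Suc (N - Suc j)" by simp
  moreover have "(\<Prod>i=2..Suc j. 1 - q ^ (N + 1 - i)) = (\<Prod>i=2..j. 1 - q ^ (N + 1 - i)) * (1 - q ^ (N - j))"
    using step by simp
  ultimately show ?case using step by (simp add: qpoch_Suc mult_ac)
qed simp

text \<open>
  Instantiated with the coefficients \<open>u\<close> of the infinite product and with the sums \<open>G\<close> of
  numerators of a given weight. Keeping the factor \<open>1 - q ^ N\<close> on the left avoids division, so
  that the argument works in every commutative ring.
\<close>

lemma coeff_times_qpoch: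
  fixes q :: "'b::comm_ring_1"
  assumes u0: "u 0 = 1" and G0: "G 0 = 1"
    and u: "\<And>N. N \<ge> 1 \<Longrightarrow> u N * (1 - q ^ N) = q ^ N * (\<Sum>j=1..k. if j \<le> N then u (N - j) else 0)"
    and G: "\<And>N. N \<ge> 1 \<Longrightarrow> G N = q ^ N * (\<Sum>j=1..k. if j \<le> N
      then (\<Prod>i=2..j. 1 - q ^ (N + 1 - i)) * G (N - j) else 0)"
  shows "u N * qpoch q q N = G N"
proof (induction N rule: less_induct)
  case (less N)
  show ?case
  proof (cases "N = 0")
    case True
    then show ?thesis by (simp add: u0 G0 qpoch_def)
  next
    case False
    have r: "qpoch q q N = (1 - q ^ N) * qpoch q q (N - 1)"
      using qpoch_Suc[of q "N - 1"] False by (simp add: mult.commute)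
    have "u N * qpoch q q N = (u N * (1 - q ^ N)) * qpoch q q (N - 1)"
      unfolding r by (simp only: mult_ac)
    also have "\<dots> = q ^ N * (\<Sum>j=1..k. (if j \<le> N then u (N - j) else 0) * qpoch q q (N - 1))"
      using u False by (simp add: sum_distrib_right mult.assoc)
    also have "(\<Sum>j=1..k. (if j \<le> N then u (N - j) else 0) * qpoch q q (N - 1))
        = (\<Sum>j=1..k. if j \<le> N then (\<Prod>i=2..j. 1 - q ^ (N + 1 - i)) * G (N - j) else 0)"
    proof (intro sum.cong refl)
      fix j assume j: "j \<in> {1..k}"
      show "(if j \<le> N then u (N - j) else 0) * qpoch q q (N - 1) =
        (if j \<le> N then (\<Prod>i=2..j. 1 - q ^ (N + 1 - i)) * G (N - j) else 0)"
      proof (cases "j \<le> N")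
        case True
        have "u (N - j) * qpoch q q (N - 1)
            = (\<Prod>i=2..j. 1 - q ^ (N + 1 - i)) * (u (N - j) * qpoch q q (N - j))"
          using j True by (subst qpoch_peel[of j N q]) (simp_all only: mult_ac atLeastAtMost_iff)
        then show ?thesis using less[of "N - j"] j False True by simp
      qed simp
    qed
    finally show ?thesis using G False by simp
  qed
qed


section \<open>Swapping the two variables\<close>

definition swap_vars :: "'a::comm_ring_1 fps fps \<Rightarrow> 'a fps fps" where
  "swap_vars f = Abs_fps (\<lambda>n. Abs_fps (\<lambda>m. f $ m $ n))"

lemma swap_vars_nth [simp]: "swap_vars f $ n $ m = f $ m $ n"
  by (simp add: swap_vars_def)

lemma swap_vars_mult: "swap_vars (f * g) = swap_vars f * swap_vars g"
proof (intro fps_ext)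
  fix n m
  have "swap_vars (f * g) $ n $ m = (\<Sum>i=0..m. \<Sum>j=0..n. f $ i $ j * g $ (m - i) $ (n - j))"
    by (simp add: fps_mult_nth fps_sum_nth)
  also have "\<dots> = (\<Sum>j=0..n. \<Sum>i=0..m. f $ i $ j * g $ (m - i) $ (n - j))"
    by (rule sum.swap)
  also have "\<dots> = (swap_vars f * swap_vars g) $ n $ m"
    by (simp add: fps_mult_nth fps_sum_nth)
  finally show "swap_vars (f * g) $ n $ m = (swap_vars f * swap_vars g) $ n $ m" .
qed

lemma swap_vars_one: "swap_vars 1 = 1"
  by (intro fps_ext) simp

lemma swap_vars_zero: "swap_vars 0 = 0"
  by (intro fps_ext) simp

lemma swap_vars_add: "swap_vars (f + g) = swap_vars f + swap_vars g"
  by (intro fps_ext) simp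

lemma swap_vars_diff: "swap_vars (f - g) = swap_vars f - swap_vars g"
  by (intro fps_ext) simp

lemma swap_vars_of_int: "swap_vars (of_int a) = of_int a"
  by (intro fps_ext) (simp add: fps_of_int[symmetric])

lemma swap_vars_X: "swap_vars fps_X = fps_const fps_X"
  by (intro fps_ext) (simp add: fps_X_def)

lemma swap_vars_const_X: "swap_vars (fps_const fps_X) = fps_X"
  by (intro fps_ext) (simp add: fps_X_def)

lemma swap_vars_power: "swap_vars (f ^ n) = swap_vars f ^ n"
  by (induction n) (simp_all add: swap_vars_one swap_vars_mult)

lemma swap_vars_prod: "swap_vars (prod f A) = (\<Prod>i\<in>A. swap_vars (f i))"
  by (induction A rule: infinite_finite_induct) (simp_all add: swap_vars_one swap_vars_mult)

lemmas swap_vars_hom = swap_vars_mult swap_vars_one swap_vars_zero swap_vars_add swap_vars_diff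
  swap_vars_of_int swap_vars_X swap_vars_const_X swap_vars_power swap_vars_prod

lemma swap_vars_eval_int:
  "swap_vars (eval_int p fps_X) = fps_const (eval_int p (fps_X :: 'a::comm_ring_1 fps))"
  by (induction p) (simp_all add: eval_int_pCons swap_vars_hom fps_of_int
      flip: fps_const_add fps_const_mult)

section \<open>The functional equation of the infinite products\<close>

text \<open>Each coefficient of a product depends on finitely many coefficients of the factors.\<close>

lemma fps_tendsto_mult:
  fixes f g :: "'c \<Rightarrow> 'b::comm_ring_1 fps"
  assumes "(f \<longlongrightarrow> a) F" "(g \<longlongrightarrow> b) F"
  shows "((\<lambda>x. f x * g x) \<longlongrightarrow> a * b) F"
proof (rule tendsto_fpsI)
  fix m
  have "eventually (\<lambda>x. \<forall>i\<in>{..m}. f x $ i = a $ i) F" "eventually (\<lambda>x. \<forall>i\<in>{..m}. g x $ i = b $ i) F"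
    using assms unfolding tendsto_fps_iff by (simp_all add: eventually_ball_finite)
  then show "eventually (\<lambda>x. (f x * g x) $ m = (a * b) $ m) F"
    by eventually_elim (simp add: fps_mult_nth)
qed

lemma prod_lessThan_times_shift:
  fixes f :: "nat \<Rightarrow> 'b::comm_monoid_mult"
  shows "(\<Prod>i<M. f i) * (\<Prod>i\<le>n. f (i + M)) = (\<Prod>i\<le>n + M. f i)"
proof (induction n)
  case 0
  then show ?case by (simp flip: lessThan_Suc_atMost)
next
  case (Suc n)
  then show ?case by (simp flip: mult.assoc)
qed

text \<open>
  The notion of convergence for infinite products discards finitely many initial factors.
  Multiplying them back in gives the limit of the full partial products, which is nonzero because
  every factor has constant coefficient \<open>1\<close>.
\<close>

lemma qpoch_inf_LIMSEQ:
  fixes a q :: "'b::idom fps"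
  assumes "a $ 0 = 0" "q $ 0 = 0"
  shows "(\<lambda>n. \<Prod>j\<le>n. 1 - a * q ^ j) \<longlonglongrightarrow> qpoch_inf a q"
proof -
  let ?f = "\<lambda>j. 1 - a * q ^ j"
  obtain M p where p: "(\<lambda>n. \<Prod>i\<le>n. ?f (i + M)) \<longlonglongrightarrow> p" "p \<noteq> 0"
    using convergent_prod_qpoch[OF assms] unfolding convergent_prod_def raw_has_prod_def by blast
  have "(\<lambda>n. \<Prod>i\<le>n + M. ?f i) \<longlonglongrightarrow> (\<Prod>i<M. ?f i) * p"
    using fps_tendsto_mult[OF tendsto_const p(1), of "\<Prod>i<M. ?f i"]
    by (simp only: prod_lessThan_times_shift[where f = ?f])
  then have lim: "(\<lambda>n. \<Prod>i\<le>n. ?f i) \<longlonglongrightarrow> (\<Prod>i<M. ?f i) * p"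
    by (rule LIMSEQ_offset)
  have "?f i $ 0 = 1" for i using assms by simp
  then have "?f i \<noteq> 0" for i by (metis fps_zero_nth zero_neq_one)
  then have "(\<Prod>i<M. ?f i) * p \<noteq> 0" using p(2) by simp
  with lim have "?f has_prod ((\<Prod>i<M. ?f i) * p)"
    by (simp add: has_prod_def raw_has_prod_def)
  from has_prod_unique[OF this] lim show ?thesis
    by (simp add: qpoch_inf_def)
qed

lemma qpoch_inf_head:
  fixes a q :: "'b::idom fps"
  assumes "a $ 0 = 0" "q $ 0 = 0"
  shows "qpoch_inf a q = (1 - a) * qpoch_inf (a * q) q"
proof (rule LIMSEQ_unique)
  show "(\<lambda>n. \<Prod>j\<le>Suc n. 1 - a * q ^ j) \<longlonglongrightarrow> qpoch_inf a q"
    using qpoch_inf_LIMSEQ[OF assms] by (rule LIMSEQ_Suc)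
  have "(\<lambda>n. (1 - a) * (\<Prod>j\<le>n. 1 - (a * q) * q ^ j)) \<longlonglongrightarrow> (1 - a) * qpoch_inf (a * q) q"
    by (intro fps_tendsto_mult tendsto_const qpoch_inf_LIMSEQ) (use assms in auto)
  also have "(\<lambda>n. (1 - a) * (\<Prod>j\<le>n. 1 - (a * q) * q ^ j)) = (\<lambda>n. \<Prod>j\<le>Suc n. 1 - a * q ^ j)"
    by (simp only: prod.atMost_Suc_shift) (simp add: mult_ac)
  finally show "(\<lambda>n. \<Prod>j\<le>Suc n. 1 - a * q ^ j) \<longlonglongrightarrow> (1 - a) * qpoch_inf (a * q) q" .
qed

lemma qpoch_inf_nth_eventually:
  fixes a q :: "'b::idom fps"
  assumes "a $ 0 = 0" "q $ 0 = 0"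
  shows "eventually (\<lambda>n. (\<Prod>j\<le>n. 1 - a * q ^ j) $ m = qpoch_inf a q $ m) sequentially"
  using qpoch_inf_LIMSEQ[OF assms] by (simp add: tendsto_fps_iff)

lemma fps_prod_nth_0: "prod f A $ 0 = (\<Prod>i\<in>A. f i $ 0 :: 'b::comm_ring_1)"
  by (induction A rule: infinite_finite_induct) simp_all

lemma qpoch_inf_nth_0:
  fixes a q :: "'b::idom fps"
  assumes "a $ 0 = 0" "q $ 0 = 0"
  shows "qpoch_inf a q $ 0 = 1"
proof -
  obtain n where "(\<Prod>j\<le>n. 1 - a * q ^ j) $ 0 = qpoch_inf a q $ 0"
    using qpoch_inf_nth_eventually[OF assms, of 0] by (auto simp: eventually_sequentially)
  then show ?thesis using assms by (simp add: fps_prod_nth_0)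
qed

text \<open>The substitution of \<open>xq\<close> for \<open>x\<close>, for series in \<open>x\<close> with coefficients in \<open>q\<close>.\<close>

definition dilate :: "'a::idom fps fps \<Rightarrow> 'a fps fps" where
  "dilate g = g oo (fps_const fps_X * fps_X)"

lemma dilate_nth: "dilate g $ n = fps_X ^ n * g $ n"
  by (simp add: dilate_def fps_compose_linear)

lemma dilate_mult: "dilate (f * g) = dilate f * dilate g"
  by (simp add: dilate_def fps_compose_mult_distrib)


lemma dilate_prod: "dilate (prod f A) = (\<Prod>i\<in>A. dilate (f i))"
  by (simp add: dilate_def fps_compose_prod_distrib)

lemma dilate_power: "dilate (f ^ n) = dilate f ^ n"
  by (simp add: dilate_def fps_compose_power)

lemma dilate_diff: "dilate (f - g) = dilate f - dilate g"
  by (simp add: dilate_def fps_compose_sub_distrib)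

lemma dilate_const: "dilate (fps_const c) = fps_const c"
  by (simp add: dilate_def)

lemma dilate_X: "dilate fps_X = fps_const fps_X * fps_X"
  by (simp add: dilate_def)

lemma dilate_one: "dilate 1 = 1"
  by (simp add: dilate_def)

lemmas dilate_hom = dilate_mult dilate_prod dilate_power dilate_diff dilate_const dilate_X dilate_one

text \<open>
  Continuity of the substitution: the coefficient of \<open>x\<^bsup>N\<^esup>q\<^bsup>m\<^esup>\<close> after it is that of
  \<open>x\<^bsup>N\<^esup>q\<^bsup>m-N\<^esup>\<close> before it, and both infinite products agree in their coefficient with a sufficiently
  long finite product, to which the homomorphism properties apply.
\<close>

lemma dilate_swap_qpoch_inf:
  fixes a Q :: "'a::idom fps fps"
  assumes a0: "a $ 0 = 0" and Q0: "Q $ 0 = 0"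
    and a: "dilate (swap_vars a) = swap_vars (a * Q)"
    and Q: "dilate (swap_vars Q) = swap_vars Q"
  shows "dilate (swap_vars (qpoch_inf a Q)) = swap_vars (qpoch_inf (a * Q) Q)"
proof (intro fps_ext)
  fix N m
  define P where "P b n = (\<Prod>j\<le>n. 1 - b * Q ^ j)" for b n
  have aQ0: "(a * Q) $ 0 = 0" using a0 by simp
  obtain n where n: "P a n $ (m - N) = qpoch_inf a Q $ (m - N)" "P (a * Q) n $ m = qpoch_inf (a * Q) Q $ m"
    using eventually_conj[OF qpoch_inf_nth_eventually[OF a0 Q0, of "m - N"]
        qpoch_inf_nth_eventually[OF aQ0 Q0, of m]]
    unfolding P_def eventually_sequentially by blast
  have hom: "dilate (swap_vars (P a n)) = swap_vars (P (a * Q) n)"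
    unfolding P_def by (simp add: swap_vars_hom dilate_hom a Q del: power_mult_distrib)
  have "dilate (swap_vars (qpoch_inf a Q)) $ N $ m = dilate (swap_vars (P a n)) $ N $ m"
    using n(1) by (simp add: dilate_nth fps_X_power_mult_nth)
  also have "\<dots> = swap_vars (qpoch_inf (a * Q) Q) $ N $ m"
    unfolding hom using n(2) by simp
  finally show "dilate (swap_vars (qpoch_inf a Q)) $ N $ m = swap_vars (qpoch_inf (a * Q) Q) $ N $ m" .
qed

lemma swap_qpoch_inf_eq:
  fixes a Q :: "'a::idom fps fps"
  assumes "a $ 0 = 0" "Q $ 0 = 0"
    and "dilate (swap_vars a) = swap_vars (a * Q)" "dilate (swap_vars Q) = swap_vars Q"
  shows "swap_vars (qpoch_inf a Q) = (1 - swap_vars a) * dilate (swap_vars (qpoch_inf a Q))"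
  unfolding dilate_swap_qpoch_inf[OF assms]
  by (subst qpoch_inf_head[OF assms(1,2)]) (simp add: swap_vars_hom)

lemma swap_qpoch_inf_nth_0:
  fixes a Q :: "'a::idom fps fps"
  assumes "a $ 0 = 0" "Q $ 0 = 0" "swap_vars a $ 0 = 0"
  shows "swap_vars (qpoch_inf a Q) $ 0 = 1"
proof (rule fps_ext)
  fix m
  obtain n where n: "(\<Prod>j\<le>n. 1 - a * Q ^ j) $ m = qpoch_inf a Q $ m"
    using qpoch_inf_nth_eventually[OF assms(1,2), of m] by (auto simp: eventually_sequentially)
  have "swap_vars (qpoch_inf a Q) $ 0 $ m = swap_vars (\<Prod>j\<le>n. 1 - a * Q ^ j) $ 0 $ m"
    using n by simp
  also have "swap_vars (\<Prod>j\<le>n. 1 - a * Q ^ j) $ 0 = 1"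
    using assms(3) by (simp only: swap_vars_hom fps_prod_nth_0) simp
  finally show "swap_vars (qpoch_inf a Q) $ 0 $ m = 1 $ m" .
qed

text \<open>The coefficient ring \<open>'a fps\<close> is not a field, but its inverse of \<open>1\<close> is still \<open>1\<close>.\<close>

lemma divide_mult_cancel_unit:
  fixes f g :: "'a::field fps fps"
  assumes "g $ 0 = 1"
  shows "f / g * g = f"
proof -
  have "g * inverse g = 1"
    using fps_right_inverse[of g 1] assms by (simp add: fps_inverse_def[of g])
  then show ?thesis
    using assms by (simp add: fps_divide_unit mult.assoc mult.commute[of "inverse g"])
qed

text \<open>
  Numerator \<open>A\<close> and denominator \<open>B\<close> satisfy \<open>A(x) = (1 - y\<^bsup>k+1\<^esup>) A(xq)\<close> and
  \<open>B(x) = (1 - y) B(xq)\<close> with \<open>y = xq\<close>. Since \<open>(1 - y) B(xq)\<close> is not a zero divisor, the quotient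
  satisfies \<open>u(x) = (1 + y + \<dots> + y\<^bsup>k\<^esup>) u(xq)\<close>, and the claim is the coefficient of \<open>x\<^bsup>N\<^esup>\<close>.
\<close>

lemma coeffs_of_quotient:
  fixes k :: nat
  defines "u \<equiv> swap_vars (qpoch_inf (var_x ^ (k + 1) * var_q ^ (k + 1)) (var_q ^ (k + 1))
          / qpoch_inf (var_x * var_q) var_q :: 'a::field fps fps)"
  shows "u $ 0 = 1"
    and "u $ N * (1 - fps_X ^ N) = fps_X ^ N * (\<Sum>j=1..k. if j \<le> N then u $ (N - j) else 0)"
proof -
  define A where "A = qpoch_inf (var_x ^ (k + 1) * var_q ^ (k + 1)) (var_q ^ (k + 1) :: 'a fps fps)"
  define B where "B = qpoch_inf (var_x * var_q) (var_q :: 'a fps fps)"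
  define y where "y = (fps_const fps_X * fps_X :: 'a fps fps)"
  have B0: "B $ 0 = 1"
    unfolding B_def by (rule qpoch_inf_nth_0) simp_all
  have "swap_vars (A / B * B) = swap_vars A"
    using B0 by (simp only: divide_mult_cancel_unit)
  then have uB: "u * swap_vars B = swap_vars A"
    by (simp add: u_def A_def B_def swap_vars_mult)
  have A: "swap_vars A = (1 - y ^ (k + 1)) * dilate (swap_vars A)"
  proof -
    let ?a = "var_x ^ (k + 1) * var_q ^ (k + 1) :: 'a fps fps"
    let ?Q = "var_q ^ (k + 1) :: 'a fps fps"
    have "dilate (swap_vars ?a) = swap_vars (?a * ?Q)" "dilate (swap_vars ?Q) = swap_vars ?Q"
      by (simp_all only: swap_vars_hom dilate_hom power_mult_distrib mult_ac)
    moreover have "swap_vars ?a = y ^ (k + 1)"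
      by (simp only: swap_vars_hom y_def power_mult_distrib mult.commute)
    ultimately show ?thesis
      unfolding A_def using swap_qpoch_inf_eq[of ?a ?Q] by simp
  qed
  have B: "swap_vars B = (1 - y) * dilate (swap_vars B)"
  proof -
    let ?a = "var_x * var_q :: 'a fps fps"
    let ?Q = "var_q :: 'a fps fps"
    have "dilate (swap_vars ?a) = swap_vars (?a * ?Q)" "dilate (swap_vars ?Q) = swap_vars ?Q"
      by (simp_all only: swap_vars_hom dilate_hom power_mult_distrib mult_ac)
    moreover have "swap_vars ?a = y"
      by (simp only: swap_vars_hom y_def mult.commute)
    ultimately show ?thesis
      unfolding B_def using swap_qpoch_inf_eq[of ?a ?Q] by simp
  qed
  have A1: "swap_vars A $ 0 = 1"
    unfolding A_def
    by (rule swap_qpoch_inf_nth_0) (simp_all add: swap_vars_hom del: fps_const_power fps_const_mult)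
  have B1: "swap_vars B $ 0 = 1"
    unfolding B_def by (rule swap_qpoch_inf_nth_0) (simp_all add: swap_vars_hom)
  show "u $ 0 = 1"
    using arg_cong[OF uB, of "\<lambda>f. f $ 0"] A1 B1 by simp
  have "u * ((1 - y) * dilate (swap_vars B)) = u * swap_vars B"
    by (simp only: B[symmetric])
  also have "\<dots> = (1 - y ^ (k + 1)) * dilate (u * swap_vars B)"
    unfolding uB by (rule A)
  also have "1 - y ^ (k + 1) = (1 - y) * (\<Sum>i\<le>k. y ^ i)"
    by (simp only: sum_gp_basic) simp
  finally have "((1 - y) * dilate (swap_vars B)) * u = ((1 - y) * dilate (swap_vars B)) * ((\<Sum>i\<le>k. y ^ i) * dilate u)"
    by (simp only: dilate_mult mult_ac)
  moreover have "((1 - y) * dilate (swap_vars B)) $ 0 = 1"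
    using B1 by (simp add: y_def dilate_nth)
  then have "(1 - y) * dilate (swap_vars B) \<noteq> 0" by (metis fps_zero_nth zero_neq_one)
  ultimately have "u = (\<Sum>i\<le>k. y ^ i) * dilate u"
    by (simp only: mult_cancel_left) simp
  then have "u $ N = ((\<Sum>i\<le>k. y ^ i) * dilate u) $ N" by simp
  also have "\<dots> = (\<Sum>i\<le>k. (fps_const (fps_X ^ i) * (fps_X ^ i * dilate u)) $ N)"
    by (simp add: sum_distrib_right fps_sum_nth y_def power_mult_distrib mult.assoc)
  also have "\<dots> = (\<Sum>i\<le>k. if i \<le> N then fps_X ^ N * u $ (N - i) else 0)"
  proof (intro sum.cong refl)
    fix i 
    show "(fps_const (fps_X ^ i) * (fps_X ^ i * dilate u)) $ N = (if i \<le> N then fps_X ^ N * u $ (N - i) else 0)"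
      unfolding fps_mult_left_const_nth fps_X_power_mult_nth dilate_nth
      by (auto simp: mult.assoc[symmetric] simp flip: power_add)
  qed
  also have "\<dots> = fps_X ^ N * u $ N + (\<Sum>i=1..k. if i \<le> N then fps_X ^ N * u $ (N - i) else 0)"
    unfolding atMost_atLeast0 by (subst sum.atLeast_Suc_atMost) simp_all
  also have "(\<Sum>i=1..k. if i \<le> N then fps_X ^ N * u $ (N - i) else 0)
      = fps_X ^ N * (\<Sum>j=1..k. if j \<le> N then u $ (N - j) else 0)"
    unfolding sum_distrib_left by (intro sum.cong) auto
  finally show "u $ N * (1 - fps_X ^ N) = fps_X ^ N * (\<Sum>j=1..k. if j \<le> N then u $ (N - j) else 0)"
    by (simp add: algebra_simps)
qed

section \<open>Coefficients of the summands\<close>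

lemma swap_qpoch: "swap_vars (qpoch fps_X fps_X N) = fps_const (qpoch fps_X fps_X N :: 'a::comm_ring_1 fps)"
proof -
  have "fps_const (prod f A) = (\<Prod>i\<in>A. fps_const (f i :: 'a fps))" for f :: "nat \<Rightarrow> 'a fps" and A
    by (induction A rule: infinite_finite_induct) (simp_all flip: fps_const_mult)
  then show ?thesis
    by (simp add: qpoch_def swap_vars_hom flip: fps_const_mult fps_const_power fps_const_sub)
qed

lemma swap_numer: "swap_vars (numer k fps_X n) = fps_const (numer k (fps_X :: 'a::comm_ring_1 fps) n)"
  by (simp add: numer_def swap_vars_hom swap_vars_eval_int flip: fps_const_mult fps_const_power fps_const_sub)

lemma qpoch_nth_0: "qpoch fps_X fps_X N $ 0 = (1 :: 'a::comm_ring_1)"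
  by (simp add: qpoch_def fps_prod_nth_0)

text \<open>
  After swapping the variables a summand is a monomial in \<open>x\<close> whose coefficient is a series in \<open>q\<close>.
  This is proved after multiplication by \<open>(q;q)\<^sub>N\<close>, which \<open>swap_vars\<close> respects; the inverse
  is then taken in \<open>'a fps\<close>, where \<open>'a\<close> is a field.
\<close>

lemma summand_nth:
  fixes k :: nat and n :: "nat \<Rightarrow> nat"
  defines "T \<equiv> var_q ^ (\<Sum>i=1..k. ((\<Sum>j=i..k. n j) + 1) choose 2)
        * (1 - var_q) ^ (\<Sum>i=2..k. (i - 1) * n i)
        * var_x ^ weight k n
        / qpoch var_q var_q (weight k n)
        * poly (map_poly of_int (b_poly k (\<lambda>j. int (n j)))) var_q :: 'a::field fps fps"
  shows "T $ m $ N = (if weight k n = N then (numer k fps_X n * inverse (qpoch fps_X fps_X N)) $ m else 0)"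
proof -
  let ?w = "weight k n"
  let ?Q = "qpoch fps_X fps_X ?w :: 'a fps"
  define D where "D = var_q ^ (\<Sum>i=1..k. ((\<Sum>j=i..k. n j) + 1) choose 2)
        * (1 - var_q) ^ (\<Sum>i=2..k. (i - 1) * n i) * (var_x ^ ?w :: 'a fps fps)"
  have Q0: "qpoch var_q var_q ?w $ 0 = (1 :: 'a fps)"
    by (rule qpoch_nth_0)
  have "T * qpoch var_q var_q ?w = (D / qpoch var_q var_q ?w * qpoch var_q var_q ?w)
      * eval_int (b_poly k (\<lambda>j. int (n j))) var_q"
    by (simp only: T_def D_def mult_ac)
  also have "\<dots> = var_x ^ ?w * numer k var_q n"
    unfolding divide_mult_cancel_unit[OF Q0] D_def numer_def tri_exp_def by (simp only: mult_ac)
  finally have "swap_vars (T * qpoch var_q var_q ?w) = swap_vars (var_x ^ ?w * numer k var_q n)"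
    by simp
  then have "swap_vars T * fps_const ?Q * fps_const (inverse ?Q)
      = fps_X ^ ?w * fps_const (numer k fps_X n) * fps_const (inverse ?Q)"
    by (simp add: swap_vars_mult swap_qpoch swap_numer swap_vars_power swap_vars_const_X
        del: fps_const_power)
  moreover have "?Q * inverse ?Q = 1"
    by (rule inverse_mult_eq_1') (simp add: qpoch_nth_0)
  ultimately have "swap_vars T = fps_X ^ ?w * fps_const (numer k fps_X n * inverse ?Q)"
    by (simp add: mult.assoc)
  then have "swap_vars T $ N $ m = (fps_X ^ ?w * fps_const (numer k fps_X n * inverse ?Q)) $ N $ m"
    by simp
  then show ?thesis by (auto simp: fps_X_power_mult_nth)
qed

text \<open>With \<open>s\<^sub>i = n\<^sub>i + \<dots> + n\<^sub>k\<close>, the weight is \<open>s\<^sub>1 + \<dots> + s\<^sub>k\<close>, and \<open>s \<le> (s + 1) choose 2\<close>.\<close>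

lemma weight_le_tri_exp: "weight k n \<le> tri_exp k n"
proof -
  have "weight k n = (\<Sum>l=1..k. \<Sum>i=1..k. if i \<le> l then n l else 0)"
    unfolding weight_def
  proof (intro sum.cong refl)
    fix l assume "l \<in> {1..k}"
    then have "{1..k} \<inter> {i. i \<le> l} = {1..l}" by auto
    then show "of_nat l * n l = (\<Sum>i=1..k. if i \<le> l then n l else 0)"
      by (simp add: sum.If_cases)
  qed
  also have "\<dots> = (\<Sum>i=1..k. \<Sum>l=1..k. if i \<le> l then n l else 0)"
    by (rule sum.swap)
  also have "\<dots> = (\<Sum>i=1..k. \<Sum>l=i..k. n l)"
  proof (rule sum.cong[OF refl])
    fix i assume "i \<in> {1..k}"
    then have "{1..k} \<inter> {l. i \<le> l} = {i..k}" by auto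
    then show "(\<Sum>l=1..k. if i \<le> l then n l else 0) = (\<Sum>l=i..k. n l)"
      by (simp add: sum.If_cases)
  qed
  also have "\<dots> \<le> tri_exp k n"
    unfolding tri_exp_def by (rule sum_mono) (simp add: numeral_2_eq_2)
  finally show ?thesis .
qed

lemma numer_nth_eq_0:
  assumes "m < weight k n"
  shows "(numer k fps_X n * f) $ m = (0 :: 'a::comm_ring_1)"
  using assms weight_le_tri_exp[of k n] unfolding numer_def mult.assoc
  by (simp add: fps_X_power_mult_nth)

theorem theorem3:
  fixes k :: nat
  assumes "k \<ge> 1"
  shows
    "((\<lambda>n :: nat \<Rightarrow> nat.
        var_q ^ (\<Sum>i=1..k. ((\<Sum>j=i..k. n j) + 1) choose 2)
        * (1 - var_q) ^ (\<Sum>i=2..k. (i - 1) * n i)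
        * var_x ^ weight k n
        / qpoch var_q var_q (weight k n)
        * poly (map_poly of_int (b_poly k (\<lambda>j. int (n j)))) var_q)
      has_sum
        (qpoch_inf (var_x ^ (k + 1) * var_q ^ (k + 1)) (var_q ^ (k + 1))
          / qpoch_inf (var_x * var_q) var_q :: 'a::field fps fps))
      ({1..k} \<rightarrow>\<^sub>E UNIV)"
    (is "(?T has_sum ?R) ?A")
proof (rule has_sum_fpsI)
  fix m
  let ?c = "\<lambda>n N. numer k fps_X n * inverse (qpoch fps_X fps_X N) :: 'a fps"
  \<comment> \<open>The tuples that can contribute to the coefficient of \<open>q\<^bsup>m\<^esup>\<close>.\<close>
  define W where "W = (\<Union>N\<le>m. tuples k N)"
  have finW: "finite W" by (simp add: W_def finite_tuples)
  have W: "n \<in> W \<longleftrightarrow> n \<in> ?A \<and> weight k n \<le> m" for n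
    by (auto simp: W_def tuples_def)
  have nonzero: "weight k n \<le> m" if "(numer k fps_X n * f) $ m \<noteq> 0" for n and f :: "'a fps"
    using that numer_nth_eq_0[of m k n f] by (auto simp: not_le[symmetric])
  have outside: "?T n $ m = 0" if "m < weight k n" for n
    by (rule fps_ext) (simp only: summand_nth numer_nth_eq_0[OF that], simp)
  then have sub: "{n \<in> ?A. ?T n $ m \<noteq> 0} \<subseteq> W"
    using W by (auto simp: not_le[symmetric])
  then show "finite {n \<in> ?A. ?T n $ m \<noteq> 0}"
    using finW by (rule finite_subset)
  have "(\<Sum>n | n \<in> ?A \<and> ?T n $ m \<noteq> 0. ?T n $ m) = (\<Sum>n\<in>W. ?T n $ m)"
    by (rule sum.mono_neutral_left) (use finW sub W in auto)
  also have "\<dots> = ?R $ m"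
  proof (rule fps_ext)
    fix N
    have u: "swap_vars ?R $ N * qpoch fps_X fps_X N = sum (numer k fps_X) (tuples k N)"
      by (rule coeff_times_qpoch[where k = k])
        (simp_all only: coeffs_of_quotient sum_numer_rec sum_numer_tuples_0)
    have "qpoch fps_X fps_X N * inverse (qpoch fps_X fps_X N :: 'a fps) = 1"
      by (rule inverse_mult_eq_1') (simp add: qpoch_nth_0)
    then have "swap_vars ?R $ N = swap_vars ?R $ N * qpoch fps_X fps_X N * inverse (qpoch fps_X fps_X N)"
      by (simp only: mult.assoc mult_1_right)
    also have "\<dots> = (\<Sum>n\<in>tuples k N. ?c n N)"
      unfolding u by (rule sum_distrib_right)
    finally have "?R $ m $ N = (\<Sum>n\<in>tuples k N. ?c n N $ m)"
      by (metis (no_types) swap_vars_nth fps_sum_nth)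
    also have "\<dots> = (\<Sum>n\<in>W \<inter> tuples k N. ?c n N $ m)"
      by (rule sum.mono_neutral_right)
        (use W nonzero finite_tuples[of k N] in \<open>auto simp: tuples_def\<close>)
    also have "\<dots> = (\<Sum>n\<in>W. if weight k n = N then ?c n N $ m else 0)"
      by (subst sum.inter_restrict[OF finW], rule sum.cong) (use W in \<open>auto simp: tuples_def\<close>)
    finally show "(\<Sum>n\<in>W. ?T n $ m) $ N = ?R $ m $ N"
      by (simp only: fps_sum_nth summand_nth)
  qed
  finally show "?R $ m = (\<Sum>n | n \<in> ?A \<and> ?T n $ m \<noteq> 0. ?T n $ m)" ..
qed

end
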